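(* Let $n\ge 2$, let $Z,Z_1,\dots,Z_n$ be i.i.d. random variables with values in $[0,1]$ and let $\delta>0$. Then with probability at least $1-\delta$ in the i.i.d. vector $\mathbf Z=(Z_1,\dots,Z_n)$ we have $$\mathbb{E}Z-\frac1n\sum_{i=1}^n Z_i\le \sqrt{\frac{2V_n(\mathbf Z)\ln(2/\delta)}{n}}+\frac{7\ln(2/\delta)}{3(n-1)},$$ where $V_n(\mathbf Z)$ is the sample variance $$V_n(\mathbf Z)=\frac{1}{n(n-1)}\sum_{1\le i<j\le n}(Z_i-Z_j)^2 .$$
   Context: $\mathbb{E}$ denotes expectation. For $\delta\ge 1$ the assertion is vacuous. *)

theory Defs
  imports "HOL-Probability.Probability"
begin

(* Measurability of each X i is part of indep_vars. *)
definition iid_on :: "'w measure \<Rightarrow> ('i \<Rightarrow> 'w \<Rightarrow> real) \<Rightarrow> 'i set \<Rightarrow> bool" where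
  "iid_on M X I \<longleftrightarrow>
     prob_space.indep_vars M (\<lambda>_. borel) X I \<and>
     (\<forall>i\<in>I. \<forall>j\<in>I. distr M borel (X i) = distr M borel (X j))"

(* Only the entries z 1, ..., z n are used. *)
definition sample_variance :: "nat \<Rightarrow> (nat \<Rightarrow> real) \<Rightarrow> real" where
  "sample_variance n z =
     1 / (real n * (real n - 1)) *
     (\<Sum>(i, j) \<in> {(i, j). 1 \<le> i \<and> i < j \<and> j \<le> n}. (z i - z j)\<^sup>2)"

end

theory Submission
  imports Defs "HOL-Real_Asymp.Real_Asymp"
begin

text \<open>
  With \<open>v\<close> the variance and \<open>L = ln (2/\<delta>)\<close>, two events of probability at most \<open>\<delta>/2\<close> are excluded.
  Bernstein's inequality bounds the deviation of the mean by \<open>sqrt (2vL/n) + L/(3n)\<close>.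
  For the lower tail of the sample variance, write \<open>V\<^sub>n\<close> as the average over all permutations \<open>\<pi>\<close>
  of the averages of \<open>(Z\<^sub>a - Z\<^sub>b)\<^sup>2/2\<close> over the \<open>n div 2\<close> disjoint pairs
  \<open>{a, b} = {\<pi>(2j+1), \<pi>(2j+2)}\<close> (Hoeffding's device for U-statistics). By Jensen's inequality
  it suffices to bound the Laplace transform of one such average, whose terms are independent with
  values in \<open>[0, 1/2]\<close> and mean \<open>v\<close>; since \<open>2 (n div 2) \<ge> n - 1\<close>, the Chernoff bound gives
  \<open>V\<^sub>n > v - sqrt (2vL/(n-1))\<close>, hence \<open>sqrt v \<le> sqrt V\<^sub>n + sqrt (2L/(n-1))\<close>. Inserting this into
  Bernstein's inequality yields the constant \<open>7/3 = 2 + 1/3\<close>.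
\<close>

section \<open>Quadratic upper bounds for the exponential\<close>

text \<open>With \<open>u = - y\<close>, multiplying by \<open>exp u\<close> turns the claim into
  \<open>1 \<le> (1 - u + u^2/2) * exp u\<close>. Equality holds at 0, and the derivative
  \<open>u^2/2 * exp u\<close> of the right side is nonnegative.\<close>

lemma exp_le_quadratic_nonpos:
  fixes y :: real
  assumes "y \<le> 0"
  shows "exp y \<le> 1 + y + y\<^sup>2 / 2"
proof -
  let ?f = "\<lambda>u. (1 - u + u\<^sup>2 / 2) * exp (u::real)"
  have "?f 0 \<le> ?f (- y)"
  proof (rule DERIV_nonneg_imp_nondecreasing[where f = ?f])
    fix x :: real
    have "(?f has_real_derivative (x\<^sup>2 / 2 * exp x)) (at x)"
      by (auto intro!: derivative_eq_intros simp: algebra_simps power2_eq_square)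
    then show "\<exists>d. (?f has_real_derivative d) (at x) \<and> d \<ge> 0"
      by (intro exI[of _ "x\<^sup>2 / 2 * exp x"]) simp
  qed (use assms in simp)
  then show ?thesis by (simp add: exp_minus field_simps)
qed

text \<open>Clearing the denominator and dividing by \<open>exp y\<close> leaves
  \<open>1 \<le> ?f y\<close>. Here \<open>?f 0 = 1\<close>, and \<open>?f\<close> is nondecreasing
  because its derivative is a third of \<open>1 - (1 + u + u^2/2) * exp (- u)\<close>, nonnegative
  by Taylor's bound.\<close>

lemma exp_le_bernstein_nonneg:
  fixes y :: real
  assumes "0 \<le> y" "y < 3"
  shows "exp y \<le> 1 + y + y\<^sup>2 / (2 * (1 - y / 3))"
proof -
  let ?f = "\<lambda>u. (1 + 2 * u / 3 + u\<^sup>2 / 6) * exp (- u) + u / (3::real)"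
  have "?f 0 \<le> ?f y"
  proof (rule DERIV_nonneg_imp_nondecreasing[where f = ?f])
    fix x :: real assume x: "0 \<le> x"
    have "1 + x + x\<^sup>2 / 2 \<le> exp x" using x by (rule exp_lower_Taylor_quadratic)
    then have "(1 + x + x\<^sup>2 / 2) * exp (- x) \<le> 1" by (simp add: exp_minus field_simps)
    moreover have "(?f has_real_derivative (1 - (1 + x + x\<^sup>2 / 2) * exp (- x)) / 3) (at x)"
      by (auto intro!: derivative_eq_intros simp: field_simps power2_eq_square)
    ultimately show "\<exists>d. (?f has_real_derivative d) (at x) \<and> d \<ge> 0"
      by (intro exI[of _ "(1 - (1 + x + x\<^sup>2 / 2) * exp (- x)) / 3"]) auto
  qed (use assms in simp)
  then have "exp y * (1 - y / 3) \<le> 1 + 2 * y / 3 + y\<^sup>2 / 6"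
    by (simp add: exp_minus field_simps)
  also have "\<dots> = (1 + y) * (1 - y / 3) + y\<^sup>2 / 2"
    by (simp add: field_simps power2_eq_square)
  finally have "exp y \<le> ((1 + y) * (1 - y / 3) + y\<^sup>2 / 2) / (1 - y / 3)"
    using assms by (simp add: pos_le_divide_eq)
  also have "\<dots> = 1 + y + y\<^sup>2 / (2 * (1 - y / 3))"
    using assms by (simp add: add_divide_distrib)
  finally show ?thesis .
qed

text \<open>A single quadratic must serve all values of a variable bounded above by
  \<open>\<theta>\<close>. The coefficient at \<open>\<theta>\<close> dominates both 1/2, used for
  negative \<open>y\<close>, and the coefficient at a \<open>y\<close> in between.\<close>

lemma exp_le_bernstein:
  fixes y \<theta> :: real
  assumes "y \<le> \<theta>" "0 \<le> \<theta>" "\<theta> < 3"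
  shows "exp y \<le> 1 + y + y\<^sup>2 / (2 * (1 - \<theta> / 3))"
proof (cases "y \<le> 0")
  case True
  have "y\<^sup>2 / 2 \<le> y\<^sup>2 / (2 * (1 - \<theta> / 3))"
    using assms by (intro divide_left_mono) auto
  then show ?thesis using exp_le_quadratic_nonpos[OF True] by linarith
next
  case False
  have "y\<^sup>2 / (2 * (1 - y / 3)) \<le> y\<^sup>2 / (2 * (1 - \<theta> / 3))"
    using assms by (intro divide_left_mono mult_left_mono) auto
  then show ?thesis using exp_le_bernstein_nonneg[of y] False assms by linarith
qed

section \<open>Averaging over permutations\<close>

text \<open>The symmetric group is doubly transitive, so a random permutation sends
  \<open>(a, b)\<close> to each ordered pair of distinct points equally often. The proof sums
  \<open>g (\<pi> x) (\<pi> y)\<close> over all \<open>\<pi>\<close> and all such pairs in both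
  orders of summation.\<close>

lemma sum_permutations_pair:
  fixes g :: "'a \<Rightarrow> 'a \<Rightarrow> real"
  assumes S: "finite S" and ab: "a \<in> S" "b \<in> S" "a \<noteq> b"
  shows "real (card S * (card S - 1)) * (\<Sum>\<pi> | \<pi> permutes S. g (\<pi> a) (\<pi> b)) =
    fact (card S) * (\<Sum>x\<in>S. \<Sum>y\<in>S - {x}. g x y)"
proof -
  let ?P = "{\<pi>. \<pi> permutes S}"
  have eq: "(\<Sum>\<pi>\<in>?P. g (\<pi> x) (\<pi> y)) = (\<Sum>\<pi>\<in>?P. g (\<pi> a) (\<pi> b))"
    if xy: "x \<in> S" "y \<in> S - {x}" for x y
  proof -
    \<comment> \<open>\<open>c\<close> is the preimage of \<open>y\<close> under the swap of
      \<open>a\<close> and \<open>x\<close>. As \<open>c\<close> and \<open>b\<close> differ from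
      \<open>a\<close>, the composite \<open>q\<close> sends \<open>a\<close> to \<open>x\<close>,
      and \<open>b\<close> via \<open>c\<close> to \<open>y\<close>.\<close>
    define c where "c = Transposition.transpose a x y"
    define q where "q = Transposition.transpose a x \<circ> Transposition.transpose b c"
    have c: "c \<in> S" "c \<noteq> a" using xy ab by (auto simp: c_def Transposition.transpose_def)
    have q: "q permutes S"
      unfolding q_def using xy ab c by (intro permutes_compose permutes_swap_id) auto
    have "q a = x" "q b = y"
      using ab c by (auto simp: q_def c_def Transposition.transpose_def split: if_splits)
    then show ?thesis
      using sum_permutations_compose_right[OF q, of "\<lambda>\<pi>. g (\<pi> a) (\<pi> b)"] by simp
  qed
  \<comment> \<open>The other side of the double count: a fixed \<open>\<pi>\<close> merely relabels
    the ordered pairs of distinct points.\<close>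
  have "(\<Sum>x\<in>S. \<Sum>y\<in>S - {x}. g x y) = (\<Sum>x\<in>S. \<Sum>y\<in>S - {x}. g (\<pi> x) (\<pi> y))"
    if \<pi>: "\<pi> permutes S" for \<pi>
  proof -
    have "(\<Sum>x\<in>S. \<Sum>y\<in>S - {x}. g x y) = (\<Sum>x\<in>S. \<Sum>y\<in>S - {\<pi> x}. g (\<pi> x) y)"
      using sum.permute[OF \<pi>, of "\<lambda>x. \<Sum>y\<in>S - {x}. g x y"] by (simp add: o_def)
    also have "\<dots> = (\<Sum>x\<in>S. \<Sum>y\<in>S - {x}. g (\<pi> x) (\<pi> y))"
    proof (rule sum.cong[OF refl])
      fix x assume "x \<in> S"
      have "bij_betw \<pi> (S - {x}) (\<pi> ` (S - {x}))"
        using permutes_inj_on[OF \<pi>] by (rule inj_on_imp_bij_betw)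
      moreover have "\<pi> ` (S - {x}) = S - {\<pi> x}"
        using permutes_image[OF \<pi>] permutes_inj[OF \<pi>] by (auto simp: inj_def)
      ultimately show "(\<Sum>y\<in>S - {\<pi> x}. g (\<pi> x) y) = (\<Sum>y\<in>S - {x}. g (\<pi> x) (\<pi> y))"
        by (metis sum.reindex_bij_betw)
    qed
    finally show ?thesis .
  qed
  then have "(\<Sum>\<pi>\<in>?P. \<Sum>x\<in>S. \<Sum>y\<in>S - {x}. g x y) =
      (\<Sum>\<pi>\<in>?P. \<Sum>x\<in>S. \<Sum>y\<in>S - {x}. g (\<pi> x) (\<pi> y))"
    by (rule sum.cong[OF refl]) simp
  also have "\<dots> = (\<Sum>x\<in>S. \<Sum>y\<in>S - {x}. \<Sum>\<pi>\<in>?P. g (\<pi> x) (\<pi> y))"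
    by (subst sum.swap, intro sum.cong refl, subst sum.swap, simp)
  also have "\<dots> = (\<Sum>x\<in>S. \<Sum>y\<in>S - {x}. \<Sum>\<pi>\<in>?P. g (\<pi> a) (\<pi> b))"
    by (intro sum.cong refl eq)
  finally show ?thesis
    using S by (simp add: card_permutations sum_distrib_right[symmetric] mult.assoc)
qed

section \<open>Laplace transforms and Bernstein's inequality\<close>

context prob_space
begin

text \<open>Markov's inequality after exponentiation; the Chernoff parameter is to be absorbed into
  both \<open>X\<close> and \<open>t\<close>.\<close>

lemma chernoff_bound:
  fixes X :: "'a \<Rightarrow> real"
  assumes int: "integrable M (\<lambda>\<omega>. exp (X \<omega>))"
  shows "prob {\<omega> \<in> space M. t \<le> X \<omega>} \<le> exp (- t) * expectation (\<lambda>\<omega>. exp (X \<omega>))"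
proof -
  have "prob {\<omega> \<in> space M. exp t \<le> exp (X \<omega>)} \<le> expectation (\<lambda>\<omega>. exp (X \<omega>)) / exp t"
    using integral_Markov_inequality_measure[OF int, where A = "{}" and c = "exp t"]
    by simp
  then show ?thesis by (simp add: exp_minus field_simps)
qed

lemma integrable_bounded:
  fixes X :: "'a \<Rightarrow> real"
  assumes "random_variable borel X" "\<And>\<omega>. \<omega> \<in> space M \<Longrightarrow> \<bar>X \<omega>\<bar> \<le> B"
  shows "integrable M X"
  using assms by (intro integrable_const_bound[where B = B]) auto

text \<open>Integrating the quadratic bound kills the linear term, as the mean is 0;
  \<open>1 + x \<le> exp x\<close> then gives a form that multiplies well.\<close>

lemma bernstein_mgf:
  fixes X :: "'a \<Rightarrow> real"
  assumes X[measurable]: "random_variable borel X"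
    and bnd: "\<And>\<omega>. \<omega> \<in> space M \<Longrightarrow> \<bar>X \<omega>\<bar> \<le> 1"
    and mean: "expectation X = 0" and \<theta>: "0 \<le> \<theta>" "\<theta> < 3"
  shows "expectation (\<lambda>\<omega>. exp (\<theta> * X \<omega>)) \<le>
    exp (\<theta>\<^sup>2 * expectation (\<lambda>\<omega>. (X \<omega>)\<^sup>2) / (2 * (1 - \<theta> / 3)))"
proof -
  have i1: "integrable M X" using bnd by (intro integrable_bounded) auto
  have i2: "integrable M (\<lambda>\<omega>. (X \<omega>)\<^sup>2)"
    using bnd by (intro integrable_bounded[where B = 1]) (auto simp: abs_square_le_1)
  have ie: "integrable M (\<lambda>\<omega>. exp (\<theta> * X \<omega>))"
    using bnd \<theta> by (intro integrable_bounded[where B = "exp \<theta>"]) (auto simp: abs_le_iff mult_left_le)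
  have "expectation (\<lambda>\<omega>. exp (\<theta> * X \<omega>)) \<le>
      expectation (\<lambda>\<omega>. 1 + \<theta> * X \<omega> + \<theta>\<^sup>2 / (2 * (1 - \<theta> / 3)) * (X \<omega>)\<^sup>2)"
  proof (rule integral_mono[OF ie])
    show "integrable M (\<lambda>\<omega>. 1 + \<theta> * X \<omega> + \<theta>\<^sup>2 / (2 * (1 - \<theta> / 3)) * (X \<omega>)\<^sup>2)"
      using i1 i2 by auto
    fix \<omega> assume "\<omega> \<in> space M"
    then have "\<theta> * X \<omega> \<le> \<theta>" using bnd[of \<omega>] \<theta> by (auto simp: abs_le_iff mult_left_le)
    from exp_le_bernstein[OF this \<theta>]
    show "exp (\<theta> * X \<omega>) \<le> 1 + \<theta> * X \<omega> + \<theta>\<^sup>2 / (2 * (1 - \<theta> / 3)) * (X \<omega>)\<^sup>2"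
      by (simp add: power_mult_distrib)
  qed
  also have "\<dots> = 1 + \<theta>\<^sup>2 * expectation (\<lambda>\<omega>. (X \<omega>)\<^sup>2) / (2 * (1 - \<theta> / 3))"
    using i1 i2 by (simp add: mean prob_space)
  also have "\<dots> \<le> exp (\<theta>\<^sup>2 * expectation (\<lambda>\<omega>. (X \<omega>)\<^sup>2) / (2 * (1 - \<theta> / 3)))"
    by (rule exp_ge_add_one_self)
  finally show ?thesis .
qed

text \<open>On \<open>[0, B]\<close> the square of \<open>X\<close> is at most \<open>B * X\<close>,
  so the quadratic term is controlled by the mean alone. This makes the later deviation of the
  sample variance scale with \<open>sqrt v\<close>.\<close>

lemma mgf_nonneg_lower:
  fixes X :: "'a \<Rightarrow> real"
  assumes X[measurable]: "random_variable borel X"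
    and bnd: "\<And>\<omega>. \<omega> \<in> space M \<Longrightarrow> 0 \<le> X \<omega> \<and> X \<omega> \<le> B"
    and t: "0 \<le> t"
  shows "expectation (\<lambda>\<omega>. exp (- t * X \<omega>)) \<le>
    exp (- t * expectation X + t\<^sup>2 * B * expectation X / 2)"
proof -
  have i1: "integrable M X" using bnd by (intro integrable_bounded[where B = B]) auto
  have ie: "integrable M (\<lambda>\<omega>. exp (- t * X \<omega>))"
    using bnd t by (intro integrable_bounded[where B = 1]) auto
  have "expectation (\<lambda>\<omega>. exp (- t * X \<omega>)) \<le>
      expectation (\<lambda>\<omega>. 1 + - t * X \<omega> + t\<^sup>2 * B / 2 * X \<omega>)"
  proof (rule integral_mono[OF ie])
    show "integrable M (\<lambda>\<omega>. 1 + - t * X \<omega> + t\<^sup>2 * B / 2 * X \<omega>)"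
      using i1 by auto
    fix \<omega> assume w: "\<omega> \<in> space M"
    have "t\<^sup>2 * (X \<omega> * X \<omega>) \<le> t\<^sup>2 * (B * X \<omega>)"
      using bnd[OF w] by (intro mult_left_mono mult_right_mono) auto
    moreover have "exp (- t * X \<omega>) \<le> 1 + - t * X \<omega> + (- t * X \<omega>)\<^sup>2 / 2"
      using bnd[OF w] t by (intro exp_le_quadratic_nonpos) auto
    ultimately show "exp (- t * X \<omega>) \<le> 1 + - t * X \<omega> + t\<^sup>2 * B / 2 * X \<omega>"
      by (simp add: power2_eq_square algebra_simps)
  qed
  also have "\<dots> = 1 + (- t * expectation X + t\<^sup>2 * B * expectation X / 2)"
    using i1 by (simp add: prob_space)
  also have "\<dots> \<le> exp (- t * expectation X + t\<^sup>2 * B * expectation X / 2)"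
    by (rule exp_ge_add_one_self)
  finally show ?thesis .
qed

lemma expectation_exp_sum_indep:
  fixes X :: "'i \<Rightarrow> 'a \<Rightarrow> real"
  assumes ind: "indep_vars (\<lambda>_. borel) X I" and I: "finite I"
    and int: "\<And>i. i \<in> I \<Longrightarrow> integrable M (\<lambda>\<omega>. exp (X i \<omega>))"
  shows "integrable M (\<lambda>\<omega>. exp (\<Sum>i\<in>I. X i \<omega>))"
    and "expectation (\<lambda>\<omega>. exp (\<Sum>i\<in>I. X i \<omega>)) = (\<Prod>i\<in>I. expectation (\<lambda>\<omega>. exp (X i \<omega>)))"
proof -
  have "indep_vars (\<lambda>_. borel) (\<lambda>i \<omega>. exp (X i \<omega>)) I"
    using ind by (rule indep_vars_compose2) auto
  from indep_vars_integrable[OF I this int] indep_vars_lebesgue_integral[OF I this int]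
  show "integrable M (\<lambda>\<omega>. exp (\<Sum>i\<in>I. X i \<omega>))"
    and "expectation (\<lambda>\<omega>. exp (\<Sum>i\<in>I. X i \<omega>)) = (\<Prod>i\<in>I. expectation (\<lambda>\<omega>. exp (X i \<omega>)))"
    using I by (simp_all add: exp_sum)
qed

text \<open>The Chernoff parameter is written through \<open>s\<close>; at
  \<open>s = sqrt (2 * L / v)\<close> the exponent is exactly \<open>- L\<close>, so no quadratic
  inequality needs to be inverted.\<close>

lemma bernstein_inequality:
  fixes X :: "'i \<Rightarrow> 'a \<Rightarrow> real"
  assumes ind: "indep_vars (\<lambda>_. borel) X I" and I: "finite I"
    and bnd: "\<And>i \<omega>. i \<in> I \<Longrightarrow> \<omega> \<in> space M \<Longrightarrow> \<bar>X i \<omega>\<bar> \<le> 1"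
    and mean: "\<And>i. i \<in> I \<Longrightarrow> expectation (X i) = 0"
    and v: "v = (\<Sum>i\<in>I. expectation (\<lambda>\<omega>. (X i \<omega>)\<^sup>2))" and L: "0 \<le> L"
  shows "prob {\<omega> \<in> space M. sqrt (2 * v * L) + L / 3 \<le> (\<Sum>i\<in>I. X i \<omega>)} \<le> exp (- L)"
proof -
  let ?t = "sqrt (2 * v * L) + L / 3"
  let ?p = "prob {\<omega> \<in> space M. ?t \<le> (\<Sum>i\<in>I. X i \<omega>)}"
  have rv[measurable]: "random_variable borel (X i)" if "i \<in> I" for i
    using ind that by (simp add: indep_vars_def)
  have v0: "0 \<le> v" unfolding v by (intro sum_nonneg) simp
  have *: "?p \<le> exp ((- s * ?t + v * s\<^sup>2 / 2) / (1 + s / 3))" if s: "0 < s" for s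
  proof -
    \<comment> \<open>chosen so that \<open>1 - \<theta>/3 = 1/(1 + s/3)\<close>\<close>
    define \<theta> where "\<theta> = s / (1 + s / 3)"
    have \<theta>: "0 < \<theta>" "\<theta> < 3" using s by (auto simp: \<theta>_def field_simps)
    have ind': "indep_vars (\<lambda>_. borel) (\<lambda>i \<omega>. \<theta> * X i \<omega>) I"
      using ind by (rule indep_vars_compose2) auto
    have int: "integrable M (\<lambda>\<omega>. exp (\<theta> * X i \<omega>))" if "i \<in> I" for i
      using bnd \<theta> that
      by (intro integrable_bounded[where B = "exp \<theta>"]) (auto simp: abs_le_iff mult_left_le)
    note E = expectation_exp_sum_indep[OF ind' I int, simplified]
    have "?p = prob {\<omega> \<in> space M. \<theta> * ?t \<le> (\<Sum>i\<in>I. \<theta> * X i \<omega>)}"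
      using \<theta> by (simp add: sum_distrib_left[symmetric])
    also have "\<dots> \<le> exp (- (\<theta> * ?t)) * expectation (\<lambda>\<omega>. exp (\<Sum>i\<in>I. \<theta> * X i \<omega>))"
      by (rule chernoff_bound[OF E(1)])
    also have "\<dots> \<le> exp (- (\<theta> * ?t)) *
        (\<Prod>i\<in>I. exp (\<theta>\<^sup>2 * expectation (\<lambda>\<omega>. (X i \<omega>)\<^sup>2) / (2 * (1 - \<theta> / 3))))"
      unfolding E(2) using bnd mean \<theta>
      by (intro mult_left_mono prod_mono conjI bernstein_mgf) auto
    also have "\<dots> = exp (- (\<theta> * ?t) + \<theta>\<^sup>2 * v / (2 * (1 - \<theta> / 3)))"
      using I unfolding exp_add v sum_distrib_left sum_divide_distrib
      by (simp only: exp_sum)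
    also have "1 - \<theta> / 3 = 1 / (1 + s / 3)" using s by (simp add: \<theta>_def field_simps)
    also have "- (\<theta> * ?t) + \<theta>\<^sup>2 * v / (2 * (1 / (1 + s / 3))) =
        (- s * ?t + v * s\<^sup>2 / 2) / (1 + s / 3)"
    proof -
      define r where "r = 1 + s / 3"
      have r: "r > 0" "\<theta> = s / r" using s by (simp_all add: r_def \<theta>_def)
      have "- (\<theta> * ?t) + \<theta>\<^sup>2 * v / (2 * (1 / r)) = (- s * ?t + v * s\<^sup>2 / 2) / r"
        unfolding r(2) using r(1) by (simp add: field_simps power2_eq_square)
      then show ?thesis by (simp add: r_def)
    qed
    finally show ?thesis .
  qed
  show ?thesis
  proof (cases "v = 0 \<or> L = 0")
    case False
    then have pos: "v > 0" "L > 0" using v0 L by auto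
    define s where "s = sqrt (2 * L / v)"
    have s: "0 < s" using pos by (simp add: s_def)
    have 1: "s * sqrt (2 * v * L) = 2 * L"
    proof -
      have "s * sqrt (2 * v * L) = sqrt ((2 * L)\<^sup>2)"
        unfolding s_def real_sqrt_mult[symmetric] using pos by (simp add: field_simps power2_eq_square)
      then show ?thesis using pos by (simp only: real_sqrt_abs)
    qed
    have 2: "v * s\<^sup>2 = 2 * L" using pos by (simp add: s_def)
    \<comment> \<open>By 1 and 2 the left side is \<open>- 2 * L - s * L / 3 + L\<close>.\<close>
    have "- s * ?t + v * s\<^sup>2 / 2 = - L * (1 + s / 3)" using 1 2 by (simp add: algebra_simps)
    then have "(- s * ?t + v * s\<^sup>2 / 2) / (1 + s / 3) = - L" using s by simp
    then show ?thesis using *[OF s] by simp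
  next
    case True
    show ?thesis
    proof (cases "L = 0")
      case True then show ?thesis by simp
    next
      case False
      then have "v = 0" using True by simp
      \<comment> \<open>the optimal \<open>s = sqrt (2L/v)\<close> of the other case is infinite here, so let \<open>s\<close> tend to infinity\<close>
      have "((\<lambda>s. exp ((- s * (L / 3)) / (1 + s / 3))) \<longlongrightarrow> exp (- L)) at_top"
        by real_asymp
      moreover have "\<forall>\<^sub>F s in at_top. ?p \<le> exp ((- s * (L / 3)) / (1 + s / 3))"
        using eventually_gt_at_top[of "0::real"] by eventually_elim (use * \<open>v = 0\<close> in simp)
      ultimately show ?thesis by (intro tendsto_lowerbound) auto
    qed
  qed
qed

end

section \<open>The sample variance as a U-statistic\<close>

text \<open>The two orderings of a pair contribute half a squared difference each. Summation over
  ordered pairs is the form that permutation averaging requires.\<close>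

lemma sample_variance_eq_sum_off_diagonal:
  "sample_variance n z =
    (\<Sum>x\<in>{1..n}. \<Sum>y\<in>{1..n} - {x}. (z x - z y)\<^sup>2 / 2) / (real n * (real n - 1))"
proof -
  define A where "A = {(i, j). 1 \<le> i \<and> i < j \<and> j \<le> n}"
  let ?g = "\<lambda>(x, y). (z x - z y)\<^sup>2 / 2"
  have "finite A" by (rule finite_subset[of _ "{1..n} \<times> {1..n}"]) (auto simp: A_def)
  have "(\<Sum>x\<in>{1..n}. \<Sum>y\<in>{1..n} - {x}. (z x - z y)\<^sup>2 / 2) =
      sum ?g (Sigma {1..n} (\<lambda>x. {1..n} - {x}))"
    by (subst sum.Sigma) auto
  also have "Sigma {1..n} (\<lambda>x. {1..n} - {x}) = A \<union> prod.swap ` A"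
    by (force simp: A_def image_iff)
  also have "sum ?g (A \<union> prod.swap ` A) = sum ?g A + sum ?g (prod.swap ` A)"
    using \<open>finite A\<close> by (intro sum.union_disjoint) (auto simp: A_def)
  also have "sum ?g (prod.swap ` A) = sum ?g A"
    by (subst sum.reindex) (auto simp: case_prod_unfold power2_commute intro!: sum.cong inj_onI)
  also have "sum ?g A + sum ?g A = (\<Sum>(x, y)\<in>A. (z x - z y)\<^sup>2)"
    unfolding sum.distrib[symmetric] by (intro sum.cong) auto
  finally show ?thesis by (simp add: sample_variance_def A_def)
qed

text \<open>For each fixed \<open>j\<close> the average over permutations is already the sample
  variance, by \<open>sum_permutations_pair\<close>; averaging over \<open>j\<close> as well changes
  nothing.\<close>

lemma sample_variance_eq_permutation_average:
  assumes n: "2 \<le> n"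
  shows "sample_variance n z =
    (\<Sum>\<pi> | \<pi> permutes {1..n}. 1 / fact n *
      ((\<Sum>j<n div 2. (z (\<pi> (2 * j + 1)) - z (\<pi> (2 * j + 2)))\<^sup>2 / 2) / real (n div 2)))"
proof -
  have *: "(\<Sum>\<pi> | \<pi> permutes {1..n}. (z (\<pi> (2 * j + 1)) - z (\<pi> (2 * j + 2)))\<^sup>2 / 2) =
      fact n * sample_variance n z" if "j < n div 2" for j
  proof -
    let ?T = "\<Sum>\<pi> | \<pi> permutes {1..n}. (z (\<pi> (2 * j + 1)) - z (\<pi> (2 * j + 2)))\<^sup>2 / 2"
    let ?D = "\<Sum>x\<in>{1..n}. \<Sum>y\<in>{1..n} - {x}. (z x - z y)\<^sup>2 / 2"
    have "2 * j + 1 \<in> {1..n}" "2 * j + 2 \<in> {1..n}" using that by auto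
    from sum_permutations_pair[OF _ this, of "\<lambda>x y. (z x - z y)\<^sup>2 / 2"]
    have "real n * (real n - 1) * ?T = fact n * ?D"
      using n by (simp add: of_nat_diff)
    moreover have "real n * (real n - 1) \<noteq> 0" using n by simp
    ultimately show ?thesis
      unfolding sample_variance_eq_sum_off_diagonal
      by (simp add: eq_divide_eq mult.commute)
  qed
  have "(\<Sum>\<pi> | \<pi> permutes {1..n}. \<Sum>j<n div 2. (z (\<pi> (2 * j + 1)) - z (\<pi> (2 * j + 2)))\<^sup>2 / 2) =
      (\<Sum>j<n div 2. fact n * sample_variance n z)"
    by (subst sum.swap) (use * in \<open>intro sum.cong[OF refl], simp\<close>)
  then show ?thesis
    using n unfolding sum_distrib_left[symmetric] sum_divide_distrib[symmetric]
    by simp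
qed

lemma sample_variance_nonneg: "0 \<le> sample_variance n z"
proof -
  \<comment> \<open>For \<open>n = 0\<close> the second factor is negative, but the product is
    0.\<close>
  have "0 \<le> real n * (real n - 1)" by (cases n) auto
  then show ?thesis
    unfolding sample_variance_eq_sum_off_diagonal
    by (intro divide_nonneg_nonneg sum_nonneg) auto
qed

section \<open>Lower tail of the sample variance\<close>

context prob_space
begin

text \<open>Expanding the square, independence gives the cross term \<open>\<mu>^2\<close>, which
  cancels the squared mean in the second moments.\<close>

lemma expectation_half_square_diff:
  fixes X :: "'i \<Rightarrow> 'a \<Rightarrow> real"
  assumes ind: "indep_vars (\<lambda>_. borel) X I" and ab: "a \<in> I" "b \<in> I" "a \<noteq> b"
    and bnd: "\<And>i \<omega>. i \<in> I \<Longrightarrow> \<omega> \<in> space M \<Longrightarrow> \<bar>X i \<omega>\<bar> \<le> 1"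
    and mean: "\<And>i. i \<in> I \<Longrightarrow> expectation (X i) = \<mu>"
    and second: "\<And>i. i \<in> I \<Longrightarrow> expectation (\<lambda>\<omega>. (X i \<omega>)\<^sup>2) = \<mu>\<^sup>2 + v"
  shows "expectation (\<lambda>\<omega>. (X a \<omega> - X b \<omega>)\<^sup>2 / 2) = v"
proof -
  have [measurable]: "random_variable borel (X i)" if "i \<in> I" for i
    using ind that by (simp add: indep_vars_def)
  have int: "integrable M (X i)" "integrable M (\<lambda>\<omega>. (X i \<omega>)\<^sup>2)" if "i \<in> I" for i
    using bnd that by (auto intro!: integrable_bounded[where B = 1] simp: abs_square_le_1)
  have "indep_vars (\<lambda>_. borel) X {a, b}"
    using ab by (intro indep_vars_subset[OF ind]) auto
  from indep_vars_lebesgue_integral[OF _ this] indep_vars_integrable[OF _ this]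
  have "expectation (\<lambda>\<omega>. X a \<omega> * X b \<omega>) = \<mu>\<^sup>2" and "integrable M (\<lambda>\<omega>. X a \<omega> * X b \<omega>)"
    using int ab mean by (auto simp: power2_eq_square)
  moreover have "(X a \<omega> - X b \<omega>)\<^sup>2 / 2 = (X a \<omega>)\<^sup>2 / 2 + (X b \<omega>)\<^sup>2 / 2 - X a \<omega> * X b \<omega>" for \<omega>
    by (simp add: power2_eq_square field_simps)
  ultimately show ?thesis
    using int ab second by simp
qed

text \<open>For one \<open>\<pi>\<close> the pairs are disjoint, so the half squared differences are
  independent. Each lies in \<open>[0, 1/2]\<close> with mean \<open>v\<close>, and
  \<open>mgf_nonneg_lower\<close> applies with \<open>B = 1/2\<close>.\<close>

lemma mgf_pairing_average:
  fixes Z :: "nat \<Rightarrow> 'a \<Rightarrow> real"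
  assumes n: "2 \<le> n" and ind: "indep_vars (\<lambda>_. borel) Z {1..n}"
    and bnd: "\<And>i \<omega>. i \<in> {1..n} \<Longrightarrow> \<omega> \<in> space M \<Longrightarrow> Z i \<omega> \<in> {0..1}"
    and mean: "\<And>i. i \<in> {1..n} \<Longrightarrow> expectation (Z i) = \<mu>"
    and second: "\<And>i. i \<in> {1..n} \<Longrightarrow> expectation (\<lambda>\<omega>. (Z i \<omega>)\<^sup>2) = \<mu>\<^sup>2 + v"
    and \<pi>: "\<pi> permutes {1..n}" and \<theta>: "0 \<le> \<theta>"
  shows "expectation (\<lambda>\<omega>. exp (- \<theta> *
      ((\<Sum>j<n div 2. (Z (\<pi> (2 * j + 1)) \<omega> - Z (\<pi> (2 * j + 2)) \<omega>)\<^sup>2 / 2) / real (n div 2))))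
    \<le> exp (- \<theta> * v + \<theta>\<^sup>2 * v / (4 * real (n div 2)))"
proof -
  define m where "m = n div 2"
  have m: "0 < m" using n by (simp add: m_def)
  define t where "t = \<theta> / real m"
  have t: "0 \<le> t" using \<theta> by (simp add: t_def)
  define a b where "a j = \<pi> (2 * j + 1)" and "b j = \<pi> (2 * j + 2)" for j
  define Y where "Y j \<omega> = (Z (a j) \<omega> - Z (b j) \<omega>)\<^sup>2 / 2" for j \<omega>
  have \<pi>_eq: "\<pi> x = \<pi> y \<longleftrightarrow> x = y" for x y using permutes_inj[OF \<pi>] by (simp add: inj_eq)
  have ab: "a j \<in> {1..n}" "b j \<in> {1..n}" "a j \<noteq> b j" if "j < m" for j
    using that permutes_in_image[OF \<pi>, of "2 * j + 1"] permutes_in_image[OF \<pi>, of "2 * j + 2"]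
    by (auto simp: a_def b_def m_def \<pi>_eq)
  have rv[measurable]: "random_variable borel (Z i)" if "i \<in> {1..n}" for i
    using ind that by (simp add: indep_vars_def)
  have bnd': "\<bar>Z i \<omega>\<bar> \<le> 1" if "i \<in> {1..n}" "\<omega> \<in> space M" for i \<omega>
    using bnd[OF that] by simp
  \<comment> \<open>Injectivity of \<open>\<pi>\<close> makes the index pairs disjoint, so the
    sample can be grouped into independent blocks.\<close>
  have "indep_vars (\<lambda>j. PiM {a j, b j} (\<lambda>_. borel))
      (\<lambda>j \<omega>. restrict (\<lambda>i. Z i \<omega>) {a j, b j}) {..<m}"
  proof (rule indep_vars_restrict[OF ind])
    show "disjoint_family_on (\<lambda>j. {a j, b j}) {..<m}"
      unfolding disjoint_family_on_def a_def b_def by (auto simp: \<pi>_eq)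
  qed (use ab in auto)
  then have "indep_vars (\<lambda>_. borel)
      (\<lambda>j \<omega>. (\<lambda>w. - t * ((w (a j) - w (b j))\<^sup>2 / 2)) (restrict (\<lambda>i. Z i \<omega>) {a j, b j})) {..<m}"
    by (rule indep_vars_compose2) auto
  then have indY: "indep_vars (\<lambda>_. borel) (\<lambda>j \<omega>. - t * Y j \<omega>) {..<m}"
    by (simp add: Y_def)
  have rvY[measurable]: "random_variable borel (Y j)" if "j < m" for j
    unfolding Y_def using ab[OF that] by measurable
  have Ybnd: "0 \<le> Y j \<omega> \<and> Y j \<omega> \<le> 1 / 2" if "j < m" "\<omega> \<in> space M" for j \<omega>
    using bnd[OF ab(1)[OF that(1)] that(2)] bnd[OF ab(2)[OF that(1)] that(2)]
    by (auto simp: Y_def abs_square_le_1 abs_le_iff)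
  have intY: "integrable M (\<lambda>\<omega>. exp (- t * Y j \<omega>))" if "j < m" for j
    using Ybnd that t by (intro integrable_bounded[where B = 1]) auto
  have EY: "expectation (Y j) = v" if "j < m" for j
    unfolding Y_def by (rule expectation_half_square_diff[OF ind ab[OF that] bnd' mean second])
  have "expectation (\<lambda>\<omega>. exp (\<Sum>j<m. - t * Y j \<omega>)) =
      (\<Prod>j<m. expectation (\<lambda>\<omega>. exp (- t * Y j \<omega>)))"
    by (rule expectation_exp_sum_indep(2)[OF indY]) (use intY in auto)
  also have "\<dots> \<le> (\<Prod>j<m. exp (- t * v + t\<^sup>2 * (1 / 2) * v / 2))"
  proof (intro prod_mono conjI)
    fix j assume "j \<in> {..<m}"
    then have j: "j < m" by simp
    show "expectation (\<lambda>\<omega>. exp (- t * Y j \<omega>)) \<le> exp (- t * v + t\<^sup>2 * (1 / 2) * v / 2)"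
      using mgf_nonneg_lower[OF rvY[OF j] Ybnd[OF j] t] by (simp add: EY[OF j])
  qed simp
  also have "\<dots> = exp (real m * (- t * v + t\<^sup>2 * (1 / 2) * v / 2))"
    by (simp add: exp_of_nat_mult)
  also have "real m * (- t * v + t\<^sup>2 * (1 / 2) * v / 2) = - \<theta> * v + \<theta>\<^sup>2 * v / (4 * real m)"
    using m by (simp add: t_def field_simps power2_eq_square)
  also have "(\<lambda>\<omega>. exp (\<Sum>j<m. - t * Y j \<omega>)) =
      (\<lambda>\<omega>. exp (- \<theta> * ((\<Sum>j<m. Y j \<omega>) / real m)))"
    unfolding sum_distrib_left[symmetric] by (simp add: t_def)
  finally show ?thesis by (simp only: Y_def a_def b_def m_def)
qed

text \<open>The averages \<open>W \<pi>\<close> for different \<open>\<pi>\<close> are dependent,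
  but convexity of \<open>exp\<close> bounds the Laplace transform of their mean by the mean of
  their transforms, which share one bound.\<close>

lemma sample_variance_lower_tail:
  fixes Z :: "nat \<Rightarrow> 'a \<Rightarrow> real"
  assumes n: "2 \<le> n" and ind: "indep_vars (\<lambda>_. borel) Z {1..n}"
    and bnd: "\<And>i \<omega>. i \<in> {1..n} \<Longrightarrow> \<omega> \<in> space M \<Longrightarrow> Z i \<omega> \<in> {0..1}"
    and mean: "\<And>i. i \<in> {1..n} \<Longrightarrow> expectation (Z i) = \<mu>"
    and second: "\<And>i. i \<in> {1..n} \<Longrightarrow> expectation (\<lambda>\<omega>. (Z i \<omega>)\<^sup>2) = \<mu>\<^sup>2 + v"
    and v: "0 < v" and L: "0 \<le> L"
  shows "prob {\<omega> \<in> space M. sample_variance n (\<lambda>i. Z i \<omega>) \<le> v - sqrt (2 * v * L / (real n - 1))}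
    \<le> exp (- L)"
proof -
  let ?V = "\<lambda>\<omega>. sample_variance n (\<lambda>i. Z i \<omega>)"
  define s where "s = sqrt (2 * v * L / (real n - 1))"
  \<comment> \<open>This minimizes the final exponent
    \<open>- \<theta> * s + \<theta>^2 * v / (2 * (real n - 1))\<close>; the minimum is
    \<open>- L\<close>.\<close>
  define \<theta> where "\<theta> = s * (real n - 1) / v"
  have n1: "0 < real n - 1" using n by simp
  have s: "0 \<le> s" "s\<^sup>2 = 2 * v * L / (real n - 1)" using v L n1 by (auto simp: s_def)
  have \<theta>: "0 \<le> \<theta>" using s v n1 by (simp add: \<theta>_def)
  define P where "P = {\<pi>. \<pi> permutes {1..n}}"
  define W where "W \<pi> \<omega> =
    (\<Sum>j<n div 2. (Z (\<pi> (2 * j + 1)) \<omega> - Z (\<pi> (2 * j + 2)) \<omega>)\<^sup>2 / 2) / real (n div 2)" for \<pi> \<omega>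
  have P: "finite P" "card P = fact n" "P \<noteq> {}"
    using permutes_id[of "{1..n}"] by (auto simp: P_def card_permutations finite_permutations simp del: permutes_id)
  have VW: "?V \<omega> = (\<Sum>\<pi>\<in>P. 1 / fact n * W \<pi> \<omega>)" for \<omega>
    unfolding P_def W_def by (rule sample_variance_eq_permutation_average[OF n])
  have [measurable]: "random_variable borel (Z i)" if "i \<in> {1..n}" for i
    using ind that by (simp add: indep_vars_def)
  have [measurable]: "random_variable borel (W \<pi>)" if "\<pi> \<in> P" for \<pi>
  proof -
    have "\<pi> i \<in> {1..n}" if "i \<in> {1..n}" for i
      using \<open>\<pi> \<in> P\<close> that permutes_in_image[of \<pi> "{1..n}" i] by (simp add: P_def)
    then show ?thesis unfolding W_def by measurable
  qed
  have [measurable]: "random_variable borel ?V"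
    unfolding VW by measurable
  have W0: "0 \<le> W \<pi> \<omega>" for \<pi> \<omega> by (auto simp: W_def intro!: divide_nonneg_nonneg sum_nonneg)
  have intW: "integrable M (\<lambda>\<omega>. exp (- \<theta> * W \<pi> \<omega>))" if "\<pi> \<in> P" for \<pi>
    using W0 \<theta> that by (intro integrable_bounded[where B = 1]) auto
  have intV: "integrable M (\<lambda>\<omega>. exp (- \<theta> * ?V \<omega>))"
    using sample_variance_nonneg \<theta> by (intro integrable_bounded[where B = 1]) auto
  have "expectation (\<lambda>\<omega>. exp (- \<theta> * ?V \<omega>)) \<le>
      expectation (\<lambda>\<omega>. \<Sum>\<pi>\<in>P. 1 / fact n * exp (- \<theta> * W \<pi> \<omega>))"
  proof (rule integral_mono[OF intV])
    show "integrable M (\<lambda>\<omega>. \<Sum>\<pi>\<in>P. 1 / fact n * exp (- \<theta> * W \<pi> \<omega>))"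
      using intW by auto
    fix \<omega>
    \<comment> \<open>Jensen's inequality with the uniform weights
      \<open>1 / fact n\<close>.\<close>
    have "exp (\<Sum>\<pi>\<in>P. (1 / fact n) *\<^sub>R (- \<theta> * W \<pi> \<omega>)) \<le>
        (\<Sum>\<pi>\<in>P. 1 / fact n * exp (- \<theta> * W \<pi> \<omega>))"
      using P by (intro convex_on_sum[OF _ _ exp_convex]) auto
    then show "exp (- \<theta> * ?V \<omega>) \<le> (\<Sum>\<pi>\<in>P. 1 / fact n * exp (- \<theta> * W \<pi> \<omega>))"
      by (simp add: VW sum_distrib_left sum_negf mult.commute mult.left_commute)
  qed
  also have "\<dots> = (\<Sum>\<pi>\<in>P. 1 / fact n * expectation (\<lambda>\<omega>. exp (- \<theta> * W \<pi> \<omega>)))"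
    using intW by (subst Bochner_Integration.integral_sum) auto
  also have "\<dots> \<le> (\<Sum>\<pi>\<in>P. 1 / fact n * exp (- \<theta> * v + \<theta>\<^sup>2 * v / (4 * real (n div 2))))"
    unfolding W_def using mgf_pairing_average[OF n ind bnd mean second _ \<theta>]
    by (intro sum_mono mult_left_mono) (auto simp: P_def)
  also have "\<dots> = exp (- \<theta> * v + \<theta>\<^sup>2 * v / (4 * real (n div 2)))"
    using P by simp
  also have "\<dots> \<le> exp (- \<theta> * v + \<theta>\<^sup>2 * v / (2 * (real n - 1)))"
  proof -
    \<comment> \<open>Equality for odd \<open>n\<close>, where one index stays unpaired; hence
      \<open>n - 1\<close> rather than \<open>n\<close>.\<close>
    have "real n - 1 \<le> 2 * real (n div 2)" by linarith
    then show ?thesis using v n1 by (auto intro!: divide_left_mono)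
  qed
  finally have E: "expectation (\<lambda>\<omega>. exp (- \<theta> * ?V \<omega>)) \<le>
    exp (- \<theta> * v + \<theta>\<^sup>2 * v / (2 * (real n - 1)))" .
  have "prob {\<omega> \<in> space M. ?V \<omega> \<le> v - s} \<le> prob {\<omega> \<in> space M. \<theta> * s - \<theta> * v \<le> - \<theta> * ?V \<omega>}"
  proof (rule finite_measure_mono)
    show "{\<omega> \<in> space M. ?V \<omega> \<le> v - s} \<subseteq> {\<omega> \<in> space M. \<theta> * s - \<theta> * v \<le> - \<theta> * ?V \<omega>}"
    proof safe
      fix \<omega> assume "?V \<omega> \<le> v - s"
      from mult_left_mono[OF this \<theta>] show "\<theta> * s - \<theta> * v \<le> - \<theta> * ?V \<omega>"
        by (simp add: algebra_simps)
    qed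
  qed measurable
  also have "\<dots> \<le> exp (- (\<theta> * s - \<theta> * v)) * expectation (\<lambda>\<omega>. exp (- \<theta> * ?V \<omega>))"
    by (rule chernoff_bound[OF intV])
  also have "\<dots> \<le> exp (- (\<theta> * s - \<theta> * v)) * exp (- \<theta> * v + \<theta>\<^sup>2 * v / (2 * (real n - 1)))"
    using E by (rule mult_left_mono) simp
  also have "\<dots> = exp (- (s\<^sup>2 * (real n - 1) / (2 * v)))"
  proof -
    have "(s * d / v)\<^sup>2 * v / (2 * d) = s\<^sup>2 * d / (2 * v)" if "0 < d" for d
      using v that by (simp add: power2_eq_square)
    from this[OF n1] have "\<theta>\<^sup>2 * v / (2 * (real n - 1)) = s\<^sup>2 * (real n - 1) / (2 * v)"
      by (simp only: \<theta>_def)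
    moreover have "\<theta> * s = s\<^sup>2 * (real n - 1) / v"
      by (simp add: \<theta>_def power2_eq_square)
    ultimately show ?thesis by (simp add: exp_add[symmetric] field_simps)
  qed
  also have "s\<^sup>2 * (real n - 1) / (2 * v) = L" unfolding s(2) using v n1 by simp
  finally show ?thesis by (simp only: s_def)
qed

end

section \<open>Combination of the two tail bounds\<close>

text \<open>\<open>v - sqrt (2 * v * l)\<close> factors as
  \<open>sqrt v * (sqrt v - sqrt (2 * l))\<close>. Were the claim false, both factors of
  \<open>sqrt V * sqrt V\<close> would be dominated by these, contradicting
  \<open>dev\<close>.\<close>

lemma sqrt_le_of_lower_deviation:
  assumes v: "0 < v" and V: "0 \<le> V" and l: "0 \<le> l" and dev: "v - sqrt (2 * v * l) < V"
  shows "sqrt v \<le> sqrt V + sqrt (2 * l)"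
proof (rule ccontr)
  assume "\<not> ?thesis"
  then have lt: "sqrt V < sqrt v - sqrt (2 * l)" by simp
  have "0 \<le> sqrt V" using V by simp
  then have pos: "0 < sqrt v - sqrt (2 * l)" using lt by linarith
  have "0 \<le> sqrt (2 * l)" using l by simp
  have "V = (sqrt V)\<^sup>2" using V by simp
  also have "\<dots> = sqrt V * sqrt V" by (rule power2_eq_square)
  also have "\<dots> \<le> sqrt v * (sqrt v - sqrt (2 * l))"
    using lt pos \<open>0 \<le> sqrt V\<close> \<open>0 \<le> sqrt (2 * l)\<close> by (intro mult_mono) linarith+
  also have "\<dots> = v - sqrt (2 * v * l)"
    using v l by (simp add: right_diff_distrib real_sqrt_mult)
  finally show False using dev by simp
qed

theorem theorem4:
  fixes M :: "'w measure" and Z :: "nat \<Rightarrow> 'w \<Rightarrow> real" and n :: nat and \<delta> :: real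
  assumes "prob_space M"
    and "n \<ge> 2"
    (* Z 0 is the generic copy Z; the sample is Z 1, ..., Z n *)
    and "iid_on M Z {0..n}"
    and "\<And>i \<omega>. i \<in> {0..n} \<Longrightarrow> \<omega> \<in> space M \<Longrightarrow> Z i \<omega> \<in> {0..1}"
    and "\<delta> > 0"
  shows "prob_space.prob M {\<omega> \<in> space M.
           prob_space.expectation M (Z 0) - (1 / real n) * (\<Sum>i=1..n. Z i \<omega>)
             \<le> sqrt (2 * sample_variance n (\<lambda>i. Z i \<omega>) * ln (2 / \<delta>) / real n)
               + 7 * ln (2 / \<delta>) / (3 * (real n - 1))}
         \<ge> 1 - \<delta>"
proof (cases "\<delta> < 1")
  case False
  then show ?thesis using measure_nonneg[of M] by (meson diff_le_0_iff_le not_less order_trans)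
next
  case True
  interpret prob_space M by fact
  note n = \<open>n \<ge> 2\<close> and bnd = assms(4)
  define L where "L = ln (2 / \<delta>)"
  have "0 < L" using True \<open>\<delta> > 0\<close> by (simp add: L_def)
  \<comment> \<open>Each of the two exceptional events is allotted half of
    \<open>\<delta>\<close>.\<close>
  have expL: "exp (- L) = \<delta> / 2" using \<open>\<delta> > 0\<close> by (simp add: L_def exp_minus)
  define \<mu> where "\<mu> = expectation (Z 0)"
  define v where "v = expectation (\<lambda>\<omega>. (Z 0 \<omega>)\<^sup>2) - \<mu>\<^sup>2"
  let ?V = "\<lambda>\<omega>. sample_variance n (\<lambda>i. Z i \<omega>)"
  let ?D = "\<lambda>\<omega>. \<Sum>i=1..n. \<mu> - Z i \<omega>"
  have ind0: "indep_vars (\<lambda>_. borel) Z {0..n}"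
    and dis: "\<forall>i\<in>{0..n}. \<forall>j\<in>{0..n}. distr M borel (Z i) = distr M borel (Z j)"
    using assms(3) unfolding iid_on_def by blast+
  have ind: "indep_vars (\<lambda>_. borel) Z {1..n}"
    by (rule indep_vars_subset[OF ind0]) auto
  have rv[measurable]: "random_variable borel (Z i)" if "i \<in> {0..n}" for i
    using ind0 that by (simp add: indep_vars_def)
  have same: "expectation (\<lambda>\<omega>. f (Z i \<omega>)) = expectation (\<lambda>\<omega>. f (Z 0 \<omega>))"
    if "i \<in> {0..n}" "f \<in> borel_measurable borel" for i and f :: "real \<Rightarrow> real"
  proof -
    have "0 \<in> {0..n}" by simp
    then have "distr M borel (Z i) = distr M borel (Z 0)" using dis that(1) by blast
    then show ?thesis
      using integral_distr[OF rv[OF that(1)] that(2)]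
        integral_distr[OF rv[OF \<open>0 \<in> {0..n}\<close>] that(2)] by simp
  qed
  have mean: "expectation (Z i) = \<mu>" if "i \<in> {0..n}" for i
    using same[OF that, of "\<lambda>x. x"] by (simp add: \<mu>_def)
  have second: "expectation (\<lambda>\<omega>. (Z i \<omega>)\<^sup>2) = \<mu>\<^sup>2 + v" if "i \<in> {0..n}" for i
    using same[OF that, of "\<lambda>x. x\<^sup>2"] by (simp add: v_def)
  have int: "integrable M (Z i)" "integrable M (\<lambda>\<omega>. (Z i \<omega>)\<^sup>2)" if "i \<in> {0..n}" for i
    using bnd[OF that] that
    by (auto intro!: integrable_bounded[where B = 1] simp: abs_square_le_1 abs_le_iff)
  have var: "expectation (\<lambda>\<omega>. (\<mu> - Z i \<omega>)\<^sup>2) = v" if "i \<in> {0..n}" for i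
  proof -
    have "(\<mu> - Z i \<omega>)\<^sup>2 = \<mu>\<^sup>2 - 2 * \<mu> * Z i \<omega> + (Z i \<omega>)\<^sup>2" for \<omega>
      by (simp add: power2_eq_square algebra_simps)
    then have "expectation (\<lambda>\<omega>. (\<mu> - Z i \<omega>)\<^sup>2) =
        \<mu>\<^sup>2 - 2 * \<mu> * expectation (Z i) + expectation (\<lambda>\<omega>. (Z i \<omega>)\<^sup>2)"
      using int[OF that] by (simp add: prob_space)
    also have "\<dots> = v"
      unfolding mean[OF that] second[OF that] by (simp add: power2_eq_square)
    finally show ?thesis .
  qed
  have v0: "0 \<le> v" using var[of 0] Bochner_Integration.integral_nonneg[of M "\<lambda>\<omega>. (\<mu> - Z 0 \<omega>)\<^sup>2"] by simp
  have \<mu>01: "0 \<le> \<mu>" "\<mu> \<le> 1"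
    using int[of 0] bnd[of 0] integral_mono[of M "Z 0" "\<lambda>_. 1"]
    by (auto simp: \<mu>_def prob_space intro!: Bochner_Integration.integral_nonneg)

  \<comment> \<open>The Bernstein event for the sum instead of the mean; the total variance is
    \<open>real n * v\<close>.\<close>
  define A where "A = {\<omega> \<in> space M. sqrt (2 * (real n * v) * L) + L / 3 \<le> ?D \<omega>}"
  \<comment> \<open>For \<open>v = 0\<close> the second set would be
    \<open>?V \<omega> \<le> 0\<close>, an event of probability one, so nothing is excluded then;
    the bound on \<open>sqrt v\<close> is trivial in that case.\<close>
  define B where "B = (if v = 0 then {} else
    {\<omega> \<in> space M. ?V \<omega> \<le> v - sqrt (2 * v * L / (real n - 1))})"
  have [measurable]: "random_variable borel ?V"
    unfolding sample_variance_eq_sum_off_diagonal by measurable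
  have [measurable]: "A \<in> events" unfolding A_def by measurable
  have [measurable]: "B \<in> events" unfolding B_def by (cases "v = 0") (simp, simp, measurable)
  have "prob A \<le> exp (- L)"
    unfolding A_def
  proof (rule bernstein_inequality)
    show "indep_vars (\<lambda>_. borel) (\<lambda>i \<omega>. \<mu> - Z i \<omega>) {1..n}"
      using ind by (rule indep_vars_compose2) auto
    show "\<bar>\<mu> - Z i \<omega>\<bar> \<le> 1" if "i \<in> {1..n}" "\<omega> \<in> space M" for i \<omega>
      using bnd[of i \<omega>] that \<mu>01 by (auto simp: abs_le_iff)
    show "expectation (\<lambda>\<omega>. \<mu> - Z i \<omega>) = 0" if "i \<in> {1..n}" for i
      using that int mean by (simp add: prob_space)
    show "real n * v = (\<Sum>i=1..n. expectation (\<lambda>\<omega>. (\<mu> - Z i \<omega>)\<^sup>2))"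
      using var by simp
  qed (use \<open>0 < L\<close> in auto)
  moreover have "prob B \<le> exp (- L)"
  proof (cases "v = 0")
    case False
    then have "0 < v" using v0 by simp
    then show ?thesis
      unfolding B_def using False bnd mean second \<open>0 < L\<close>
      by (auto intro!: sample_variance_lower_tail[OF n ind])
  qed (simp add: B_def)
  ultimately have "prob (A \<union> B) \<le> \<delta>"
    using measure_Un_le[of A M B] expL by simp
  then have "1 - \<delta> \<le> prob (space M - (A \<union> B))"
    by (subst prob_compl) auto
  also have "\<dots> \<le> prob {\<omega> \<in> space M. \<mu> - (1 / real n) * (\<Sum>i=1..n. Z i \<omega>)
      \<le> sqrt (2 * ?V \<omega> * L / real n) + 7 * L / (3 * (real n - 1))}"
  proof (rule finite_measure_mono)
    show "space M - (A \<union> B) \<subseteq> {\<omega> \<in> space M. \<mu> - (1 / real n) * (\<Sum>i=1..n. Z i \<omega>)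
      \<le> sqrt (2 * ?V \<omega> * L / real n) + 7 * L / (3 * (real n - 1))}"
    proof safe
      fix \<omega> assume w: "\<omega> \<in> space M" "\<omega> \<notin> A" "\<omega> \<notin> B"
      have V0: "0 \<le> ?V \<omega>" by (rule sample_variance_nonneg)
      define l where "l = L / (real n - 1)"
      have l: "0 \<le> l" using \<open>0 < L\<close> n by (simp add: l_def)
      \<comment> \<open>Relaxing \<open>n\<close> to \<open>n - 1\<close> lets the linear Bernstein
        term merge with the error from the sample variance.\<close>
      have l': "L / real n \<le> l" using \<open>0 < L\<close> n unfolding l_def by (intro divide_left_mono) auto
      have sd: "sqrt v \<le> sqrt (?V \<omega>) + sqrt (2 * l)"
      proof (cases "v = 0")
        case True then show ?thesis using V0 l by simp
      next
        case False
        then show ?thesis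
          using w v0 V0 l by (intro sqrt_le_of_lower_deviation) (auto simp: B_def l_def)
      qed
      have "?D \<omega> = real n * \<mu> - (\<Sum>i=1..n. Z i \<omega>)" by (simp add: sum_subtractf)
      then have "\<mu> - (1 / real n) * (\<Sum>i=1..n. Z i \<omega>) = ?D \<omega> / real n"
        using n by (simp add: field_simps)
      also have "\<dots> \<le> (sqrt (2 * (real n * v) * L) + L / 3) / real n"
        using w by (intro divide_right_mono) (auto simp: A_def)
      also have "\<dots> = sqrt v * sqrt (2 * (L / real n)) + L / real n / 3"
      proof -
        have "2 * (real n * v) * L = (real n)\<^sup>2 * (v * (2 * (L / real n)))"
          using n by (simp add: power2_eq_square)
        then have "sqrt (2 * (real n * v) * L) = real n * (sqrt v * sqrt (2 * (L / real n)))"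
          by (simp only: real_sqrt_mult real_sqrt_abs abs_of_nat)
        then show ?thesis using n by (simp add: add_divide_distrib)
      qed
      \<comment> \<open>The main term keeps \<open>L / real n\<close>; only the cross term is
        relaxed, to \<open>2 * l\<close>, which with \<open>l / 3\<close> makes
        \<open>7 * l / 3\<close>.\<close>
      also have "\<dots> \<le> (sqrt (?V \<omega>) + sqrt (2 * l)) * sqrt (2 * (L / real n)) + l / 3"
        using sd l' \<open>0 < L\<close> by (intro add_mono mult_right_mono) auto
      also have "\<dots> \<le> sqrt (?V \<omega>) * sqrt (2 * (L / real n)) + sqrt (2 * l) * sqrt (2 * l) + l / 3"
        unfolding distrib_right using V0 l l' by (intro add_mono mult_left_mono) auto
      also have "sqrt (2 * l) * sqrt (2 * l) = 2 * l" using l by simp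
      also have "sqrt (?V \<omega>) * sqrt (2 * (L / real n)) = sqrt (2 * ?V \<omega> * L / real n)"
        by (simp add: real_sqrt_mult[symmetric] mult_ac)
      also have "sqrt (2 * ?V \<omega> * L / real n) + 2 * l + l / 3 =
          sqrt (2 * ?V \<omega> * L / real n) + 7 * L / (3 * (real n - 1))"
      proof -
        have "2 * (L / d) + L / d / 3 = 7 * L / (3 * d)" for d
          by (cases "d = 0") (simp_all add: field_simps)
        then show ?thesis by (simp only: l_def add.assoc)
      qed
      finally show "\<mu> - (1 / real n) * (\<Sum>i=1..n. Z i \<omega>)
          \<le> sqrt (2 * ?V \<omega> * L / real n) + 7 * L / (3 * (real n - 1))" .
    qed
  qed measurable
  finally show ?thesis by (simp only: \<mu>_def L_def)
qed

end
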